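(* Let $\phi:\{0,1,2,\dots\}\to[0,\infty)$ be strictly increasing with $\phi(0)=0$, $\lim_{n\to\infty}\phi(n)=\infty$, $\lim_{n\to\infty}\frac{\phi(n)}{\phi(n+1)}=1$, such that $\{\phi(n)-\phi(n-1):n\ge 1\}$ is non-increasing, and such that $\sum_{k=1}^n\frac{\phi(k)-\phi(k-1)}{\phi(k)}\to\infty$ as $n\to\infty$. Let $\nu\in(0,\infty)$ and $\pi_n:=\left(\frac{\phi(n-1)}{\phi(n)}\right)^\nu$ for $n\ge1$. Let $\lambda>0$ and let $\{\beta_n:n\ge1\}$ be a sequence of positive numbers with $\beta_n\to0$ as $n\to\infty$, such that $$1-\lambda\beta_ne^{-\beta_n}=\pi_n\quad\text{for all }n\ge1.$$ Let $\{R_n:n\ge1\}$ be independent random variables, where $R_n$ has the Neyman Type A distribution with parameters $\lambda$ and $\beta_n$, and define $$f_n(x):=\exp\Big((x-1)\frac{e^{\beta_n}-1}{\beta_n}\Big).$$ Then, for every $n\ge1$, the probabilities $q_n^{(0)}:=P(R_n=0)$ and $q_n^{(1)}:=P(R_n=1)$ satisfy $$q_n^{(0)}=f_n(\pi_n)\qquad\text{and}\qquad q_n^{(1)}=f_n(\pi_n)(1-\pi_n).$$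
   Context: $R_n$ has the Neyman Type A distribution with parameters $\lambda$ and $\beta_n$ if $R_n=\sum_{k=1}^{N_n}X_k^{(n)}$ (an empty sum being $0$), where $\{X_k^{(n)}:k\ge1\}$ are i.i.d. Poisson random variables with mean $\beta_n$, independent of the Poisson random variable $N_n$ with mean $\lambda$. *)

theory Defs
  imports "HOL-Probability.Probability"
begin

text \<open>
  The Neyman Type A distribution with parameters \<open>lam\<close> and \<open>b\<close>: the law of
  \<open>\<Sum>k=1..N. X k\<close>, where \<open>N\<close> is Poisson with mean \<open>lam\<close>, the \<open>X k\<close> (\<open>k \<ge> 1\<close>) are i.i.d. Poisson
  with mean \<open>b\<close>, and \<open>N\<close> is independent of the family \<open>X\<close>. Here \<open>N\<close> and the \<open>X k\<close> are the
  coordinates on the product space; \<open>distr_sum_eq_neyman_type_A\<close> shows that the choice of the space is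
  immaterial. As in \<open>poisson_pmf\<close>, the parameters are meant to be nonnegative.
\<close>

definition neyman_type_A :: "real \<Rightarrow> real \<Rightarrow> nat measure" where
  "neyman_type_A lam b =
     distr (measure_pmf (poisson_pmf lam) \<Otimes>\<^sub>M (\<Pi>\<^sub>M k\<in>{1::nat..}. measure_pmf (poisson_pmf b)))
       (count_space UNIV) (\<lambda>(N, X). \<Sum>k=1..N. X k)"

lemma measurable_random_sum:
  "(\<lambda>(N, X). \<Sum>k=1..N. X k)
     \<in> count_space UNIV \<Otimes>\<^sub>M (\<Pi>\<^sub>M k\<in>{1::nat..}. count_space (UNIV :: nat set))
       \<rightarrow>\<^sub>M count_space UNIV"
proof -
  have "(\<lambda>z. (\<lambda>n z. \<Sum>k=1..n. snd z k) (fst z) z)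
     \<in> count_space UNIV \<Otimes>\<^sub>M (\<Pi>\<^sub>M k\<in>{1::nat..}. count_space (UNIV :: nat set))
       \<rightarrow>\<^sub>M count_space UNIV"
  proof (rule measurable_compose_countable[where f = "\<lambda>n z. \<Sum>k=1..n. snd z k" and g = fst])
    fix n :: nat
    have "(\<lambda>z. snd z k)
     \<in> count_space (UNIV :: nat set) \<Otimes>\<^sub>M (\<Pi>\<^sub>M k\<in>{1::nat..}. count_space (UNIV :: nat set))
       \<rightarrow>\<^sub>M count_space UNIV" if "k \<in> {1..n}" for k
      using that by (intro measurable_compose[OF measurable_snd]) (auto intro: measurable_component_singleton)
    then show "(\<lambda>z. \<Sum>k=1..n. snd z k)
     \<in> count_space (UNIV :: nat set) \<Otimes>\<^sub>M (\<Pi>\<^sub>M k\<in>{1::nat..}. count_space (UNIV :: nat set))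
       \<rightarrow>\<^sub>M count_space UNIV"
    proof (induction n)
      case (Suc n)
      have "(\<lambda>z. \<Sum>k=1..n. snd z k)
       \<in> count_space (UNIV :: nat set) \<Otimes>\<^sub>M (\<Pi>\<^sub>M k\<in>{1::nat..}. count_space (UNIV :: nat set))
         \<rightarrow>\<^sub>M count_space UNIV"
        using Suc by auto
      moreover have "(\<lambda>z. snd z (Suc n))
       \<in> count_space (UNIV :: nat set) \<Otimes>\<^sub>M (\<Pi>\<^sub>M k\<in>{1::nat..}. count_space (UNIV :: nat set))
         \<rightarrow>\<^sub>M count_space UNIV"
        using Suc.prems by auto
      ultimately show ?case
        by (simp, measurable)
    qed simp
  qed simp
  then show ?thesis
    by (simp add: case_prod_unfold)
qed

lemma (in prob_space) distr_sum_eq_neyman_type_A: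
  fixes N :: "'a \<Rightarrow> nat" and X :: "nat \<Rightarrow> 'a \<Rightarrow> nat"
  assumes N: "distr M (count_space UNIV) N = measure_pmf (poisson_pmf lam)"
    and X_indep: "indep_vars (\<lambda>_. count_space UNIV) X {1..}"
    and X: "\<And>k. k \<ge> 1 \<Longrightarrow> distr M (count_space UNIV) (X k) = measure_pmf (poisson_pmf b)"
    and N_rv: "random_variable (count_space UNIV) N"
    and N_indep_X: "\<And>A B. B \<in> sets (\<Pi>\<^sub>M k\<in>{1::nat..}. count_space (UNIV :: nat set)) \<Longrightarrow>
      \<P>(\<omega> in M. N \<omega> \<in> A \<and> (\<lambda>k\<in>{1..}. X k \<omega>) \<in> B) =
      \<P>(\<omega> in M. N \<omega> \<in> A) * \<P>(\<omega> in M. (\<lambda>k\<in>{1..}. X k \<omega>) \<in> B)"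
  shows "distr M (count_space UNIV) (\<lambda>\<omega>. \<Sum>k=1..N \<omega>. X k \<omega>) = neyman_type_A lam b"
proof -
  let ?C = "count_space (UNIV :: nat set)"
  let ?P = "\<Pi>\<^sub>M k\<in>{1::nat..}. ?C"
  let ?Y = "\<lambda>\<omega>. \<lambda>k\<in>{1..}. X k \<omega>"
  note mN = N_rv
  have mY: "?Y \<in> M \<rightarrow>\<^sub>M ?P"
    using X_indep by (intro measurable_restrict) (auto simp: indep_vars_def2)
  have "distr M ?P ?Y = (\<Pi>\<^sub>M k\<in>{1..}. distr M ?C (X k))"
    using X_indep by (subst indep_vars_iff_distr_eq_PiM'[symmetric])
      (auto simp: indep_vars_def2)
  also have "\<dots> = (\<Pi>\<^sub>M k\<in>{1..}. measure_pmf (poisson_pmf b))"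
    using X by (intro PiM_cong) auto
  finally have Y: "distr M ?P ?Y = (\<Pi>\<^sub>M k\<in>{1..}. measure_pmf (poisson_pmf b))" .
  interpret N: prob_space "distr M ?C N" by (rule prob_space_distr[OF mN])
  interpret Y: prob_space "distr M ?P ?Y" by (rule prob_space_distr[OF mY])
  have "distr M ?C N \<Otimes>\<^sub>M distr M ?P ?Y = distr M (?C \<Otimes>\<^sub>M ?P) (\<lambda>\<omega>. (N \<omega>, ?Y \<omega>))"
  proof (rule pair_measure_eqI)
    fix A B assume A: "A \<in> sets (distr M ?C N)" and B: "B \<in> sets (distr M ?P ?Y)"
    have "emeasure (distr M (?C \<Otimes>\<^sub>M ?P) (\<lambda>\<omega>. (N \<omega>, ?Y \<omega>))) (A \<times> B) =
      emeasure M ((\<lambda>\<omega>. (N \<omega>, ?Y \<omega>)) -` (A \<times> B) \<inter> space M)"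
      using A B mN mY by (intro emeasure_distr) auto
    also have "(\<lambda>\<omega>. (N \<omega>, ?Y \<omega>)) -` (A \<times> B) \<inter> space M = {\<omega>\<in>space M. N \<omega> \<in> A \<and> ?Y \<omega> \<in> B}"
      by auto
    also have "emeasure M \<dots> = ennreal (\<P>(\<omega> in M. N \<omega> \<in> A) * \<P>(\<omega> in M. ?Y \<omega> \<in> B))"
      using N_indep_X[of B A] B by (simp add: emeasure_eq_measure)
    also have "\<dots> = emeasure M (N -` A \<inter> space M) * emeasure M (?Y -` B \<inter> space M)"
      by (simp add: emeasure_eq_measure ennreal_mult vimage_def Int_def conj_commute)
    also have "\<dots> = emeasure (distr M ?C N) A * emeasure (distr M ?P ?Y) B"
      using A B mN mY by (simp add: emeasure_distr)
    finally show "emeasure (distr M ?C N) A * emeasure (distr M ?P ?Y) B =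
      emeasure (distr M (?C \<Otimes>\<^sub>M ?P) (\<lambda>\<omega>. (N \<omega>, ?Y \<omega>))) (A \<times> B)" by (rule sym)
  qed (unfold_locales, simp only: sets_distr, rule sets_pair_measure_cong, simp_all)
  then have pair: "distr M (?C \<Otimes>\<^sub>M ?P) (\<lambda>\<omega>. (N \<omega>, ?Y \<omega>)) =
      measure_pmf (poisson_pmf lam) \<Otimes>\<^sub>M (\<Pi>\<^sub>M k\<in>{1..}. measure_pmf (poisson_pmf b))"
    unfolding N Y by (rule sym)
  have "neyman_type_A lam b = distr M ?C ((\<lambda>(N, X). \<Sum>k=1..N. X k) \<circ> (\<lambda>\<omega>. (N \<omega>, ?Y \<omega>)))"
    unfolding neyman_type_A_def pair[symmetric]
    using mN mY by (intro distr_distr measurable_random_sum) auto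
  also have "\<dots> = distr M ?C (\<lambda>\<omega>. \<Sum>k=1..N \<omega>. X k \<omega>)"
    by (intro distr_cong) (auto intro!: sum.cong)
  finally show ?thesis by simp
qed

end

theory Submission
  imports Defs
begin

text \<open>
  Conditioning on \<open>N = n\<close>, the sum of \<open>n\<close> independent Poisson variables of mean \<open>b\<close> vanishes with
  probability \<open>exp (-b)^n\<close> and equals \<open>1\<close> with probability \<open>n * b * exp (-b)^n\<close>. Averaging over the
  Poisson variable \<open>N\<close> gives \<open>exp (lam * (exp (-b) - 1))\<close> and \<open>lam * b * exp (-b)\<close> times this value.
  The hypothesis \<open>1 - \<pi> n = lam * \<beta> n * exp (- \<beta> n)\<close> identifies the two with the asserted formulas.
\<close>

text \<open>Tonelli on the product space behind \<open>neyman_type_A\<close>: the section of the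
  event at a fixed \<open>n\<close> involves a sum with a deterministic number of terms.\<close>

lemma emeasure_neyman_type_A_singleton:
  "emeasure (neyman_type_A lam b) {j} =
    (\<integral>\<^sup>+n. emeasure (\<Pi>\<^sub>M k\<in>{1::nat..}. measure_pmf (poisson_pmf b))
       {x \<in> space (\<Pi>\<^sub>M k\<in>{1::nat..}. measure_pmf (poisson_pmf b)). (\<Sum>k=1..n. x k) = j}
     \<partial>measure_pmf (poisson_pmf lam))"
proof -
  let ?C = "count_space (UNIV :: nat set)"
  let ?P = "\<Pi>\<^sub>M k\<in>{1::nat..}. measure_pmf (poisson_pmf b)"
  let ?L = "measure_pmf (poisson_pmf lam) \<Otimes>\<^sub>M ?P"
  let ?S = "\<lambda>(N, X). \<Sum>k=1..N. X k"
  interpret P: prob_space ?P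
    by (rule prob_space_PiM) (rule measure_pmf.prob_space_axioms)
  \<comment> \<open>\<open>measurable_random_sum\<close> speaks of counting spaces; measurability
    depends only on the sigma-algebras, which agree.\<close>
  have sets_L: "sets ?L = sets (?C \<Otimes>\<^sub>M (\<Pi>\<^sub>M k\<in>{1::nat..}. ?C))"
    by (intro sets_pair_measure_cong sets_PiM_cong) auto
  have S: "?S \<in> ?L \<rightarrow>\<^sub>M ?C"
    using measurable_random_sum by (subst measurable_cong_sets[OF sets_L refl])
  have "emeasure (neyman_type_A lam b) {j} = emeasure ?L (?S -` {j} \<inter> space ?L)"
    unfolding neyman_type_A_def by (rule emeasure_distr[OF S]) simp
  also have "\<dots> = (\<integral>\<^sup>+n. emeasure ?P (Pair n -` (?S -` {j} \<inter> space ?L))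
      \<partial>measure_pmf (poisson_pmf lam))"
    by (intro P.emeasure_pair_measure_alt measurable_sets[OF S]) simp
  also have "\<dots> = (\<integral>\<^sup>+n. emeasure ?P {x \<in> space ?P. (\<Sum>k=1..n. x k) = j}
      \<partial>measure_pmf (poisson_pmf lam))"
    by (intro nn_integral_cong arg_cong[where f = "emeasure ?P"]) (auto simp: space_pair_measure)
  finally show ?thesis .
qed

text \<open>The event is a cylinder over the finite set \<open>J\<close>, so \<open>I\<close> may be
  infinite, as in the application with \<open>I = {1..}\<close>.\<close>

lemma emeasure_PiM_pmf_eq_on:
  assumes "finite J" "J \<subseteq> I"
  shows "emeasure (\<Pi>\<^sub>M i\<in>I. measure_pmf (p i)) {x \<in> space (\<Pi>\<^sub>M i\<in>I. measure_pmf (p i)). \<forall>i\<in>J. x i = a i} =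
    ennreal (\<Prod>i\<in>J. pmf (p i) (a i))"
proof -
  interpret product_prob_space "\<lambda>i. measure_pmf (p i)" I
    by (intro product_prob_spaceI measure_pmf.prob_space_axioms)
  show ?thesis
    using emeasure_PiM_Collect[of J "\<lambda>i. {a i}"] assms
    by (simp add: emeasure_pmf_single prod_ennreal)
qed

lemma emeasure_PiM_poisson_sum_eq_0:
  fixes b :: real
  assumes "b > 0" "finite J" "J \<subseteq> I"
  defines "P \<equiv> \<Pi>\<^sub>M k\<in>I. measure_pmf (poisson_pmf b)"
  shows "emeasure P {x \<in> space P. (\<Sum>k\<in>J. x k) = 0} = ennreal (exp (-b) ^ card J)"
  using emeasure_PiM_pmf_eq_on[OF assms(2,3), of "\<lambda>_. poisson_pmf b" "\<lambda>_. 0"] assms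
  by simp

text \<open>Natural numbers add up to 1 only if one of them is 1 and the others are 0. The position
  of the 1 splits the event into \<open>card J\<close> disjoint cylinders of equal mass.\<close>

lemma emeasure_PiM_poisson_sum_eq_1:
  fixes b :: real and J I :: "'a set"
  assumes "b > 0" "finite J" "J \<subseteq> I"
  defines "P \<equiv> \<Pi>\<^sub>M k\<in>I. measure_pmf (poisson_pmf b)"
  shows "emeasure P {x \<in> space P. (\<Sum>k\<in>J. x k) = 1} = ennreal (card J * b * exp (-b) ^ card J)"
proof -
  let ?E = "\<lambda>i. {x \<in> space P. \<forall>k\<in>J. x k = of_bool (k = i)}"
  have E: "emeasure P (?E i) = ennreal (b * exp (-b) ^ card J)" if "i \<in> J" for i
  proof -
    \<comment> \<open>The Poisson masses at 0 and 1 are \<open>exp (-b)\<close> and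
      \<open>b * exp (-b)\<close>, so only the factor at \<open>i\<close> contributes an extra
      \<open>b\<close>.\<close>
    have "(\<Prod>k\<in>J. pmf (poisson_pmf b) (of_bool (k = i))) = (\<Prod>k\<in>J. (if k = i then b else 1) * exp (-b))"
      using assms(1) by (intro prod.cong) auto
    also have "\<dots> = b * exp (-b) ^ card J"
      using assms(2) that by (simp add: prod.distrib)
    finally show ?thesis
      unfolding P_def using assms(2,3) by (simp add: emeasure_PiM_pmf_eq_on)
  qed
  \<comment> \<open>A non-measurable set has \<open>emeasure\<close> 0 by convention, so the
    positive value in \<open>E\<close> already forces measurability.\<close>
  have sets_E: "?E i \<in> sets P" if "i \<in> J" for i
    using E[OF that] assms(1) by (intro emeasure_neq_0_sets) simp
  have "(\<Sum>k\<in>J. x k) = 1 \<longleftrightarrow> (\<exists>i\<in>J. \<forall>k\<in>J. x k = of_bool (k = i))" for x :: "'a \<Rightarrow> nat"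
    unfolding sum_eq_1_iff[OF assms(2)]
    by (rule bex_cong[OF refl]) (metis (full_types) of_bool_eq(1,2))
  then have sum_eq_1: "{x \<in> space P. (\<Sum>k\<in>J. x k) = 1} = (\<Union>i\<in>J. ?E i)"
    by blast
  have "i = j" if "x \<in> ?E i" "x \<in> ?E j" "i \<in> J" for x i j
  proof -
    have "x i = of_bool (i = i)" "x i = of_bool (i = j)"
      using that by blast+
    then show ?thesis by (cases "i = j") simp_all
  qed
  then have "disjoint_family_on ?E J"
    unfolding disjoint_family_on_def by blast
  then have "emeasure P {x \<in> space P. (\<Sum>k\<in>J. x k) = 1} = (\<Sum>i\<in>J. emeasure P (?E i))"
    unfolding sum_eq_1 using assms(2) sets_E
    by (intro sum_emeasure[symmetric]) blast+
  also have "\<dots> = (\<Sum>i\<in>J. ennreal (b * exp (-b) ^ card J))"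
    by (intro sum.cong E) auto
  also have "\<dots> = ennreal (card J * b * exp (-b) ^ card J)"
    using assms(1) by (subst sum_ennreal) (auto simp: mult.assoc)
  finally show ?thesis .
qed

lemma nn_integral_poisson_pmf:
  assumes "lam > 0" "\<And>n. g n \<ge> 0"
    and "(\<lambda>n. (lam ^ n / fact n * exp (- lam)) * g n) sums s"
  shows "(\<integral>\<^sup>+n. ennreal (g n) \<partial>measure_pmf (poisson_pmf lam)) = ennreal s"
proof -
  have "(\<integral>\<^sup>+n. ennreal (g n) \<partial>measure_pmf (poisson_pmf lam)) =
      (\<Sum>n. ennreal ((lam ^ n / fact n * exp (- lam)) * g n))"
    unfolding nn_integral_measure_pmf nn_integral_count_space_nat
    using assms(1,2) by (intro suminf_cong) (simp only: ennreal_mult'' pmf_poisson)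
  also have "\<dots> = ennreal s"
    using assms by (intro suminf_ennreal_eq) auto
  finally show ?thesis .
qed

text \<open>This is the probability generating function of the Poisson law at \<open>s\<close>, read
  off from the exponential series at \<open>lam * s\<close>.\<close>

lemma poisson_sums_power:
  fixes lam s :: real
  shows "(\<lambda>n. (lam ^ n / fact n * exp (- lam)) * s ^ n) sums exp (lam * (s - 1))"
proof -
  have "(\<lambda>n. (lam * s) ^ n /\<^sub>R fact n * exp (- lam)) sums (exp (lam * s) * exp (- lam))"
    by (intro sums_mult2 exp_converges)
  then show ?thesis
    by (simp add: power_mult_distrib field_simps flip: exp_add)
qed

text \<open>The value is \<open>s\<close> times the derivative of the generating function. Instead
  of differentiating, the proof cancels \<open>n\<close> against \<open>fact n\<close> and shifts
  the index.\<close>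

lemma poisson_sums_nat_power:
  fixes lam s :: real
  shows "(\<lambda>n. (lam ^ n / fact n * exp (- lam)) * (real n * s ^ n)) sums (lam * s * exp (lam * (s - 1)))"
    (is "?t sums ?v")
proof -
  have "(\<lambda>n. lam * s * ((lam ^ n / fact n * exp (- lam)) * s ^ n)) sums ?v"
    by (intro sums_mult poisson_sums_power)
  also have "(\<lambda>n. lam * s * ((lam ^ n / fact n * exp (- lam)) * s ^ n)) = (\<lambda>n. ?t (Suc n))"
    by (simp add: fun_eq_iff field_simps del: of_nat_Suc)
  \<comment> \<open>The term at index 0 vanishes, so the shifted and the full series have the same
    sum.\<close>
  finally show ?thesis
    by (subst (asm) sums_Suc_iff) simp
qed

lemma emeasure_neyman_type_A_0:
  assumes "lam > 0" "b > 0"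
  shows "emeasure (neyman_type_A lam b) {0} = ennreal (exp (lam * (exp (-b) - 1)))"
  unfolding emeasure_neyman_type_A_singleton using assms
  \<comment> \<open>The generating function is taken at \<open>s = exp (-b)\<close>. Left active,
    \<open>sum_eq_0_iff\<close> would rewrite the event before the lemma could match it.\<close>
  by (simp add: emeasure_PiM_poisson_sum_eq_0 nn_integral_poisson_pmf[OF _ _ poisson_sums_power]
    del: sum_eq_0_iff)

lemma emeasure_neyman_type_A_1:
  assumes "lam > 0" "b > 0"
  shows "emeasure (neyman_type_A lam b) {1} =
    ennreal (lam * b * exp (-b) * exp (lam * (exp (-b) - 1)))"
proof -
  have "(\<lambda>n. (lam ^ n / fact n * exp (- lam)) * (real n * b * exp (-b) ^ n)) sums
      (b * (lam * exp (-b) * exp (lam * (exp (-b) - 1))))"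
    using sums_mult[OF poisson_sums_nat_power[of lam "exp (-b)"], of b] by (simp add: mult_ac)
  from nn_integral_poisson_pmf[OF assms(1) _ this] show ?thesis
    unfolding emeasure_neyman_type_A_singleton using assms
    by (subst emeasure_PiM_poisson_sum_eq_1) (auto simp: mult_ac)
qed

theorem proposition4p1:
  fixes \<phi> :: "nat \<Rightarrow> real" and \<nu> lam :: real and \<pi> \<beta> :: "nat \<Rightarrow> real"
    and M :: "'a measure" and R :: "nat \<Rightarrow> 'a \<Rightarrow> nat"
    and f :: "nat \<Rightarrow> real \<Rightarrow> real"
    and q0 q1 :: "nat \<Rightarrow> real"
  assumes phi_nonneg: "\<And>n. \<phi> n \<ge> 0"
    and phi_mono: "strict_mono \<phi>"
    and phi_0: "\<phi> 0 = 0"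
    and phi_top: "filterlim \<phi> at_top sequentially"
    and phi_ratio: "(\<lambda>n. \<phi> n / \<phi> (n + 1)) \<longlonglongrightarrow> 1"
    and phi_diff: "\<And>m n. 1 \<le> m \<Longrightarrow> m \<le> n \<Longrightarrow> \<phi> n - \<phi> (n - 1) \<le> \<phi> m - \<phi> (m - 1)"
    and phi_sum: "filterlim (\<lambda>n. \<Sum>k=1..n. (\<phi> k - \<phi> (k - 1)) / \<phi> k) at_top sequentially"
    and nu_pos: "\<nu> > 0"
    and pi_def: "\<And>n. n \<ge> 1 \<Longrightarrow> \<pi> n = (\<phi> (n - 1) / \<phi> n) powr \<nu>"
    and lam_pos: "lam > 0"
    and beta_pos: "\<And>n. n \<ge> 1 \<Longrightarrow> \<beta> n > 0"
    and beta_lim: "\<beta> \<longlonglongrightarrow> 0"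
    and beta_eq: "\<And>n. n \<ge> 1 \<Longrightarrow> 1 - lam * \<beta> n * exp (- \<beta> n) = \<pi> n"
    and M: "prob_space M"
    and R_indep: "prob_space.indep_vars M (\<lambda>_. count_space UNIV) R {1..}"
    and R_distr: "\<And>n. n \<ge> 1 \<Longrightarrow> distr M (count_space UNIV) (R n) = neyman_type_A lam (\<beta> n)"
    and f_def: "\<And>n x. n \<ge> 1 \<Longrightarrow> f n x = exp ((x - 1) * ((exp (\<beta> n) - 1) / \<beta> n))"
    and q0_def: "\<And>n. n \<ge> 1 \<Longrightarrow> q0 n = \<P>(\<omega> in M. R n \<omega> = 0)"
    and q1_def: "\<And>n. n \<ge> 1 \<Longrightarrow> q1 n = \<P>(\<omega> in M. R n \<omega> = 1)"
  shows "\<forall>n\<ge>1. q0 n = f n (\<pi> n) \<and> q1 n = f n (\<pi> n) * (1 - \<pi> n)"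
proof (intro allI impI)
  fix n :: nat
  assume n: "n \<ge> 1"
  interpret prob_space M by (rule M)
  have R: "R n \<in> M \<rightarrow>\<^sub>M count_space UNIV"
    using R_indep n by (auto simp: indep_vars_def2)
  have prob_R: "\<P>(\<omega> in M. R n \<omega> = j) = measure (neyman_type_A lam (\<beta> n)) {j}" for j
    unfolding R_distr[OF n, symmetric]
    by (subst measure_distr[OF R]) (auto intro!: arg_cong[where f = prob])
  have one_minus_pi: "1 - \<pi> n = lam * \<beta> n * exp (- \<beta> n)"
    using beta_eq[OF n] by simp
  have "(\<pi> n - 1) * ((exp (\<beta> n) - 1) / \<beta> n) = - (lam * \<beta> n * exp (- \<beta> n)) * ((exp (\<beta> n) - 1) / \<beta> n)"
    unfolding one_minus_pi[symmetric] by simp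
  \<comment> \<open>The factor \<open>\<beta> n\<close> cancels, and \<open>exp (- \<beta> n) * (exp
    (\<beta> n) - 1) = 1 - exp (- \<beta> n)\<close>.\<close>
  also have "\<dots> = lam * (exp (- \<beta> n) - 1)"
    using beta_pos[OF n] by (simp add: divide_simps) (simp add: algebra_simps flip: exp_add)
  finally have f_pi: "f n (\<pi> n) = exp (lam * (exp (- \<beta> n) - 1))"
    by (simp add: f_def[OF n])
  show "q0 n = f n (\<pi> n) \<and> q1 n = f n (\<pi> n) * (1 - \<pi> n)"
    unfolding q0_def[OF n] q1_def[OF n] prob_R f_pi one_minus_pi
    unfolding measure_def using lam_pos beta_pos[OF n]
    \<comment> \<open>\<open>[simplified]\<close> turns \<open>1\<close> into \<open>Suc 0\<close>,
      the form in which the simplifier meets the singleton.\<close>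
    by (simp add: emeasure_neyman_type_A_0 emeasure_neyman_type_A_1[simplified])
qed

end
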